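(* Let $n\ge2$, $N\ge1$ be integers, $s\in(0,1)$, $p\ge1$ and $t\in(0,1)$. Let $\Omega\subset\mathbb{R}^n$ be an open, bounded Lipschitz domain, let $\tilde\Omega$ be an open, bounded set with $\Omega\Subset\tilde\Omega$, and let $w\in\mathbb{X}^{t,p}_0(\Omega,\tilde\Omega)$. For every $\lambda>0$ there exists $w_\lambda\in C^{0,t}(\mathbb{R}^n;\mathbb{R}^N)$ such that $$\begin{cases}\{x\in\mathbb{R}^n\colon w_\lambda(x)\ne w(x)\}\subset\Omega,\\[3pt] [w_\lambda]_{0,t;\mathbb{R}^n}\le c\lambda,\\[3pt] \displaystyle|\{x\in\mathbb{R}^n\colon w_\lambda(x)\neq w(x)\}|\le\frac{c}{\lambda^p}\left([w]^p_{t,p;\tilde\Omega}+\frac{\|w\|^p_{L^p(\Omega)}}{\mathrm{dist}(\Omega,\mathbb{R}^n\setminus\tilde\Omega)^{pt}}\right),\\[8pt] w_\lambda\in\mathbb{X}^{\tilde t,p}_0(\Omega,\tilde\Omega)\quad\text{for every positive }\tilde t<t,\end{cases}$$ where $c$ depends only on $n,N,t,p,\Omega$.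
   Context: For $t\in(0,1)$, $p\ge1$, $[w]_{t,p;A}:=\big(\int_A\int_A\frac{|w(x)-w(y)|^p}{|x-y|^{n+pt}}dx\,dy\big)^{1/p}$ and $[w]_{0,t;A}:=\sup_{x\ne y\in A}\frac{|w(x)-w(y)|}{|x-y|^t}$. $L^1_{2s}:=\{w\in L^1_{\mathrm{loc}}(\mathbb{R}^n;\mathbb{R}^N)\colon\int_{\mathbb{R}^n}\frac{|w(x)|}{1+|x|^{n+2s}}dx<\infty\}$ and $$\mathbb{X}^{t,p}_0(\Omega,\tilde\Omega):=\{w\in W^{t,p}(\tilde\Omega;\mathbb{R}^N)\cap L^1_{2s}\colon w\equiv0\text{ a.e. in }\mathbb{R}^n\setminus\Omega\}.$$ Here $w$ is identified with a representative (equal to $0$ everywhere outside $\Omega$). *)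

theory Defs
  imports "HOL-Analysis.Analysis"
begin

text \<open>
  Functions from \<open>real^'n\<close> to \<open>real^'m\<close> are genuine functions, not classes modulo null sets;
  measurability and integrals refer to the (completed) Lebesgue measure.
\<close>

text \<open>
  Near each boundary point, in suitable orthonormal coordinates with vertical direction \<open>e\<close>, the
  set is the strict supergraph of a Lipschitz function of the component orthogonal to \<open>e\<close>;
  \<open>g\<close> matters only on the hyperplane orthogonal to \<open>e\<close>, which plays the role of \<open>\<real>\<close> to the power
  \<open>n - 1\<close>. Connectedness is not required.
\<close>

definition lipschitz_boundary :: "(real^'n) set \<Rightarrow> bool" where
  "lipschitz_boundary \<Omega> \<longleftrightarrow>
     (\<forall>x0\<in>frontier \<Omega>. \<exists>e r L. \<exists>g :: real^'n \<Rightarrow> real.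
        norm e = 1 \<and> r > 0 \<and> L-lipschitz_on {y. y \<bullet> e = 0} g \<and>
        \<Omega> \<inter> ball x0 r = {x \<in> ball x0 r. x \<bullet> e > g (x - (x \<bullet> e) *\<^sub>R e)})"

definition bounded_lipschitz_domain :: "(real^'n) set \<Rightarrow> bool" where
  "bounded_lipschitz_domain \<Omega> \<longleftrightarrow> open \<Omega> \<and> bounded \<Omega> \<and> lipschitz_boundary \<Omega>"

definition gagliardo_energy ::
  "real \<Rightarrow> real \<Rightarrow> (real^'n) set \<Rightarrow> (real^'n \<Rightarrow> real^'m) \<Rightarrow> ennreal" where
  "gagliardo_energy t p A w =
     (\<integral>\<^sup>+x\<in>A. (\<integral>\<^sup>+y\<in>A.
        ennreal (norm (w x - w y) powr p / norm (x - y) powr (real CARD('n) + p * t))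
      \<partial>lebesgue) \<partial>lebesgue)"

text \<open>Meaningful only when the energy is finite, as it is on \<open>frac_sobolev\<close>; otherwise it is 0.\<close>

definition gagliardo_seminorm ::
  "real \<Rightarrow> real \<Rightarrow> (real^'n) set \<Rightarrow> (real^'n \<Rightarrow> real^'m) \<Rightarrow> real" where
  "gagliardo_seminorm t p A w = enn2real (gagliardo_energy t p A w) powr (1 / p)"

definition Lp_space :: "real \<Rightarrow> (real^'n) set \<Rightarrow> (real^'n \<Rightarrow> real^'m) set" where
  "Lp_space p A = {w. w \<in> borel_measurable (lebesgue_on A) \<and>
                      set_integrable lebesgue A (\<lambda>x. norm (w x) powr p)}"

definition Lp_norm :: "real \<Rightarrow> (real^'n) set \<Rightarrow> (real^'n \<Rightarrow> real^'m) \<Rightarrow> real" where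
  "Lp_norm p A w = (LINT x:A|lebesgue. norm (w x) powr p) powr (1 / p)"

definition frac_sobolev :: "real \<Rightarrow> real \<Rightarrow> (real^'n) set \<Rightarrow> (real^'n \<Rightarrow> real^'m) set" where
  "frac_sobolev t p A = {w \<in> Lp_space p A. gagliardo_energy t p A w < \<infinity>}"

definition L1_tail :: "real \<Rightarrow> (real^'n \<Rightarrow> real^'m) set" where
  "L1_tail s = {w. (\<forall>K. compact K \<longrightarrow> w absolutely_integrable_on K) \<and>
                   integrable lebesgue (\<lambda>x. norm (w x) / (1 + norm x powr (real CARD('n) + 2 * s)))}"

definition X0_space ::
  "real \<Rightarrow> real \<Rightarrow> real \<Rightarrow> (real^'n) set \<Rightarrow> (real^'n) set \<Rightarrow> (real^'n \<Rightarrow> real^'m) set" where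
  "X0_space s t p \<Omega> \<Omega>' =
     {w \<in> frac_sobolev t p \<Omega>' \<inter> L1_tail s. AE x in lebesgue. x \<notin> \<Omega> \<longrightarrow> w x = 0}"

definition holder_seminorm ::
  "real \<Rightarrow> (real^'n) set \<Rightarrow> (real^'n \<Rightarrow> real^'m) \<Rightarrow> ennreal" where
  "holder_seminorm t A w =
     (SUP (x, y) \<in> {(x, y). x \<in> A \<and> y \<in> A \<and> x \<noteq> y}.
        ennreal (norm (w x - w y) / norm (x - y) powr t))"

definition holder_space :: "real \<Rightarrow> (real^'n) set \<Rightarrow> (real^'n \<Rightarrow> real^'m) set" where
  "holder_space t A = {w. bounded (w ` A) \<and> holder_seminorm t A w < \<infinity>}"

end

theory Submission
  imports Defs
begin

text \<open>
  No maximal function is needed. Let \<open>G x\<close> be the inner integral over all of space of the Gagliardo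
  double integral of \<open>w\<close>. Averaging \<open>\<bar>w x - w z\<bar> ^ p + \<bar>w z - w y\<bar> ^ p\<close> over the points \<open>z\<close> of the ball
  with diameter the segment from \<open>x\<close> to \<open>y\<close> gives
  \<open>\<bar>w x - w y\<bar> ^ p \<le> C (G x + G y) \<bar>x - y\<bar> ^ (p t)\<close>, so \<open>w\<close> is Hoelder on \<open>{G \<le> lam ^ p}\<close>.
  If \<open>G x \<le> lam ^ p\<close> with \<open>x \<in> \<Omega>\<close> and \<open>y \<notin> \<Omega>\<close>, one averages instead over a ball of comparable size
  in the complement of \<open>\<Omega>\<close>, where \<open>w\<close> vanishes; it exists since the boundary is Lipschitz.
  Hence \<open>w\<close> is Hoelder on the union of \<open>{G \<le> lam ^ p}\<close> and the complement of \<open>\<Omega>\<close>, and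
  McShane's formula extends it. The bad set \<open>{x \<in> \<Omega>. G x > lam ^ p}\<close> is controlled by Markov's
  inequality, the part of \<open>G\<close> outside \<open>\<Omega>'\<close> being at most \<open>C \<bar>w x\<bar> ^ p / dist ^ (p t)\<close>.
\<close>

section \<open>Density of the Gagliardo energy and its measurability\<close>

text \<open>The set is a parameter because the pointwise estimates need the density over the whole
  space, while the energy of \<open>w\<close> is only known over \<Omega>'. Values in
  \<open>ennreal\<close> allow the density to be infinite at some points; these simply belong to the
  bad set.\<close>

definition frac_density ::
  "real \<Rightarrow> real \<Rightarrow> (real^'n) set \<Rightarrow> (real^'n \<Rightarrow> real^'m) \<Rightarrow> real^'n \<Rightarrow> ennreal" where
  "frac_density t p A w x =
     (\<integral>\<^sup>+y\<in>A. ennreal (norm (w x - w y) powr p / norm (x - y) powr (real CARD('n) + p * t)) \<partial>lebesgue)"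

lemma gagliardo_energy_eq_frac_density:
  "gagliardo_energy t p A w = (\<integral>\<^sup>+x\<in>A. frac_density t p A w x \<partial>lebesgue)"
  by (simp add: gagliardo_energy_def frac_density_def)

text \<open>The scalar result for completed measures is applied to each coordinate, and the finitely
  many exceptional null sets are joined.\<close>

lemma lebesgue_measurable_imp_ex_borel:
  fixes w :: "'a::euclidean_space \<Rightarrow> real^'m"
  assumes "w \<in> borel_measurable lebesgue"
  obtains w' where "w' \<in> borel_measurable borel" "AE x in lborel. w x = w' x"
proof -
  have "\<exists>f'. f' \<in> borel_measurable lborel \<and> (AE x in lborel. w x $ i = f' x)" for i
  proof -
    have "(\<lambda>x. w x $ i) \<in> borel_measurable lebesgue"
      by (rule borel_measurable_continuous_on[OF _ assms, of "\<lambda>v. v $ i"]) (intro continuous_intros)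
    from completion_ex_borel_measurable_real[OF this] show ?thesis by blast
  qed
  then obtain f where f: "\<And>i. f i \<in> borel_measurable lborel" "\<And>i. AE x in lborel. w x $ i = f i x"
    by metis
  have "(\<lambda>x. \<chi> i. f i x) \<in> borel_measurable borel"
    unfolding borel_measurable_euclidean_space[of "\<lambda>x. \<chi> i. f i x"]
    using f(1) by (auto simp: Basis_vec_def inner_axis)
  moreover have "AE x in lborel. \<forall>i\<in>UNIV. w x $ i = f i x"
    by (intro AE_finite_allI f) auto
  then have "AE x in lborel. w x = (\<chi> i. f i x)"
    by (rule AE_mp) (auto simp: vec_eq_iff)
  ultimately show thesis by (rule that)
qed

text \<open>Replacing \<open>w\<close> by a Borel function alters the integrand only for
  \<open>y\<close> in a null set, hence leaves the inner integral unchanged at every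
  \<open>x\<close> where the two functions agree. The Borel case is a parameter integral, and
  completeness of Lebesgue measure carries measurability back.\<close>

lemma borel_measurable_frac_density:
  fixes w :: "real^'n \<Rightarrow> real^'m"
  assumes w: "w \<in> borel_measurable lebesgue" and A: "A \<in> sets borel"
  shows "frac_density t p A w \<in> borel_measurable lebesgue"
proof -
  obtain w' where w'[measurable]: "w' \<in> borel_measurable borel" and eq: "AE x in lborel. w x = w' x"
    using lebesgue_measurable_imp_ex_borel[OF w] .
  define g where "g x = (\<integral>\<^sup>+y. ennreal (norm (w' x - w' y) powr p /
      norm (x - y) powr (real CARD('n) + p * t)) * indicator A y \<partial>lborel)" for x
  have [measurable]: "g \<in> borel_measurable borel"
    unfolding g_def using A by measurable
  have "frac_density t p A w x = g x" if "w x = w' x" for x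
    unfolding frac_density_def g_def nn_integral_completion
    by (rule nn_integral_cong_AE, rule AE_mp[OF eq]) (auto simp: that)
  with eq have ae: "AE x in lebesgue. frac_density t p A w x = g x"
    by (auto intro: AE_completion)
  have "{x \<in> space lebesgue. frac_density t p A w x \<in> S} \<in> sets lebesgue" if S: "S \<in> sets borel" for S
  proof (rule complete_measure.in_sets_AE[of lebesgue "{x. g x \<in> S}"])
    show "AE x in lebesgue. (x \<in> {x. g x \<in> S}) = (x \<in> {x \<in> space lebesgue. frac_density t p A w x \<in> S})"
      using ae by auto
    have "{x \<in> space borel. g x \<in> S} \<in> sets borel" using S by measurable
    then show "{x. g x \<in> S} \<in> sets lebesgue" by auto
    show "{x \<in> space lebesgue. frac_density t p A w x \<in> S} \<subseteq> space lebesgue" by simp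
  qed (rule completion.complete_measure_axioms)
  then show ?thesis by (intro measurableI) (auto simp: vimage_def Int_def conj_commute)
qed

section \<open>Integrals of powers of the distance over dyadic shells\<close>

text \<open>The least \<open>k\<close> satisfying the lower bound works: its predecessor violates
  that bound, which is the upper bound for \<open>k\<close>, and for \<open>k = 0\<close> the upper
  bound is \<open>u \<le> 1\<close>.\<close>

lemma ex_dyadic_scale:
  fixes u :: real
  assumes "0 < u" "u \<le> 1"
  shows "\<exists>k. (1/2)^k / 2 \<le> u \<and> u \<le> (1/2)^k"
proof -
  obtain m where "(1/2)^m < u" using real_arch_pow_inv[of u "1/2"] assms by auto
  then have ex: "\<exists>k. (1/2)^k / 2 \<le> u" by (intro exI[of _ m]) (simp add: field_simps add_pos_pos)
  define k where "k = (LEAST k. (1/2)^k / 2 \<le> u)"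
  have 1: "(1/2)^k / 2 \<le> u" unfolding k_def using LeastI_ex[OF ex] .
  have "u \<le> (1/2)^k"
  proof (cases k)
    case (Suc j)
    then have "\<not> (1/2)^j / 2 \<le> u" using not_less_Least[of j "\<lambda>k. (1/2)^k / 2 \<le> u"] k_def by auto
    then show ?thesis using Suc by auto
  qed (use assms in auto)
  with 1 show ?thesis by blast
qed

text \<open>The extreme ratio is 1/2 for \<open>a \<ge> 0\<close> and 1 for \<open>a < 0\<close>;
  the absolute value in the exponent of the constant covers both signs. Negative \<open>a\<close>
  does occur, in the energy of Hoelder functions when \<open>p\<close> is large.\<close>

lemma powr_le_of_half_le:
  fixes a \<rho> \<nu> :: real
  assumes "0 < \<rho>" "\<rho> / 2 \<le> \<nu>" "\<nu> \<le> \<rho>"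
  shows "\<nu> powr - a \<le> 2 powr \<bar>a\<bar> * \<rho> powr - a"
proof -
  have "(\<nu> / \<rho>) powr - a \<le> 2 powr \<bar>a\<bar>"
  proof (cases "a \<ge> 0")
    case True
    have "(\<nu> / \<rho>) powr - a \<le> (1/2) powr - a"
      using True assms by (intro powr_mono2') (auto simp: field_simps)
    then show ?thesis using True by (simp add: powr_minus powr_divide)
  next
    case False
    have "(\<nu> / \<rho>) powr - a \<le> 1 powr - a"
      using False assms by (intro powr_mono2) (auto simp: field_simps)
    also have "1 powr - a \<le> 2 powr \<bar>a\<bar>" by (simp add: ge_one_powr_ge_zero)
    finally show ?thesis .
  qed
  moreover have "\<nu> powr - a = (\<nu> / \<rho>) powr - a * \<rho> powr - a"
    using assms by (simp add: powr_divide)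
  ultimately show ?thesis by (simp add: mult_right_mono)
qed

text \<open>On the shell of radius \<open>R * b^k\<close> the integrand is comparable to
  \<open>(R * b^k) powr - a\<close>, and the volume of the ball adds the dimension to the exponent,
  so a geometric series of ratio \<open>b powr (real DIM('a) - a)\<close> remains. Taking
  \<open>b = 1/2\<close> treats the singularity at \<open>x\<close> and \<open>b = 2\<close> the
  decay at infinity.\<close>

lemma nn_integral_norm_powr_dyadic:
  fixes x :: "'a::euclidean_space"
  assumes "0 < b" "b powr (real DIM('a) - a) < 1" "0 < R"
    and cov: "\<And>y. y \<in> A \<Longrightarrow> y \<noteq> x \<Longrightarrow> \<exists>k. R * b^k / 2 \<le> norm (x - y) \<and> norm (x - y) \<le> R * b^k"
  shows "(\<integral>\<^sup>+y\<in>A. ennreal (norm (x - y) powr - a) \<partial>lebesgue) \<le>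
    ennreal (2 powr \<bar>a\<bar> * unit_ball_vol (real DIM('a)) * R powr (real DIM('a) - a) /
      (1 - b powr (real DIM('a) - a)))"
proof -
  define q where "q = b powr (real DIM('a) - a)"
  define C where "C = 2 powr \<bar>a\<bar> * unit_ball_vol (real DIM('a)) * R powr (real DIM('a) - a)"
  have C: "C \<ge> 0" unfolding C_def by (intro mult_nonneg_nonneg) auto
  have q: "0 \<le> q" "q < 1" using assms(1,2) by (simp_all add: q_def)
  \<comment> \<open>Whole balls replace the annuli: the overlaps affect only the constant, and the
    volumes are explicit.\<close>
  define F where "F k y = ennreal (2 powr \<bar>a\<bar> * (R * b^k) powr - a) * indicator (cball x (R * b^k)) y" for k y
  have "(\<integral>\<^sup>+y\<in>A. ennreal (norm (x - y) powr - a) \<partial>lebesgue) \<le> (\<integral>\<^sup>+y. (\<Sum>k. F k y) \<partial>lebesgue)"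
  proof (rule nn_integral_mono)
    fix y
    show "ennreal (norm (x - y) powr - a) * indicator A y \<le> (\<Sum>k. F k y)"
    proof (cases "y \<in> A \<and> y \<noteq> x")
      case True
      then obtain k where k: "R * b^k / 2 \<le> norm (x - y)" "norm (x - y) \<le> R * b^k" using cov by blast
      have "ennreal (norm (x - y) powr - a) \<le> F k y"
        unfolding F_def using k(2) powr_le_of_half_le[OF _ k, of a] assms(1,3)
        by (simp add: dist_norm ennreal_leI)
      also have "\<dots> \<le> (\<Sum>k. F k y)"
        using sum_le_suminf[of "\<lambda>k. F k y" "{k}"] by auto
      finally show ?thesis using True by simp
    next
      case False
      \<comment> \<open>\<open>0 powr - a\<close> is 0, so the centre contributes nothing even if it
        lies in \<open>A\<close>.\<close>
      then show ?thesis by (cases "y = x") simp_all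
    qed
  qed
  also have "\<dots> = (\<Sum>k. \<integral>\<^sup>+y. F k y \<partial>lebesgue)"
    unfolding F_def
    by (intro nn_integral_suminf borel_measurable_times_ennreal borel_measurable_const
          borel_measurable_indicator sets_completionI_sets) simp
  also have "\<dots> = (\<Sum>k. ennreal (C * q^k))"
  proof (rule suminf_cong)
    fix k
    have "(\<integral>\<^sup>+y. F k y \<partial>lebesgue) =
      ennreal (2 powr \<bar>a\<bar> * (R * b^k) powr - a) * ennreal (unit_ball_vol (real DIM('a)) * (R * b^k) ^ DIM('a))"
    proof -
      have "emeasure lebesgue (cball x (R * b^k)) = ennreal (unit_ball_vol (real DIM('a)) * (R * b^k) ^ DIM('a))"
        using assms(1,3) by (subst emeasure_completion) (simp_all add: emeasure_cball)
      then show ?thesis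
        unfolding F_def by (subst nn_integral_cmult_indicator) simp_all
    qed
    also have "\<dots> = ennreal (2 powr \<bar>a\<bar> * (R * b^k) powr - a * (unit_ball_vol (real DIM('a)) * (R * b^k) ^ DIM('a)))"
      by (subst ennreal_mult') (auto intro: mult_nonneg_nonneg)
    also have "2 powr \<bar>a\<bar> * (R * b^k) powr - a * (unit_ball_vol (real DIM('a)) * (R * b^k) ^ DIM('a)) =
      2 powr \<bar>a\<bar> * unit_ball_vol (real DIM('a)) * ((R * b^k) powr (real DIM('a) - a))"
    proof -
      have "(R * b^k) powr (real DIM('a) - a) = (R * b^k) ^ DIM('a) * (R * b^k) powr - a"
        using assms(1,3) powr_add[of "R * b^k" "real DIM('a)" "- a"] by (simp add: powr_realpow)
      then show ?thesis by (simp only: ac_simps)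
    qed
    also have "(R * b^k) powr (real DIM('a) - a) = R powr (real DIM('a) - a) * q^k"
    proof -
      have "(b^k) powr (real DIM('a) - a) = q powr real k"
        using assms(1) by (simp add: q_def powr_realpow[symmetric] powr_powr mult.commute)
      then have "(b^k) powr (real DIM('a) - a) = q^k"
        using assms(1) by (simp add: q_def powr_realpow)
      then show ?thesis using assms(1,3) by (simp add: powr_mult)
    qed
    finally show "(\<integral>\<^sup>+y. F k y \<partial>lebesgue) = ennreal (C * q^k)" by (simp add: C_def mult.assoc)
  qed
  also have "\<dots> = ennreal (C * (1 / (1 - q)))"
    using C q by (intro suminf_ennreal_eq sums_mult geometric_sums) auto
  finally show ?thesis by (simp add: C_def q_def)
qed

lemma nn_integral_norm_powr_near:
  fixes x :: "'a::euclidean_space"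
  assumes "a < real DIM('a)" "0 < R" "A \<subseteq> cball x R"
  shows "(\<integral>\<^sup>+y\<in>A. ennreal (norm (x - y) powr - a) \<partial>lebesgue) \<le>
    ennreal (2 powr \<bar>a\<bar> * unit_ball_vol (real DIM('a)) * R powr (real DIM('a) - a) /
      (1 - (1/2) powr (real DIM('a) - a)))"
proof (rule nn_integral_norm_powr_dyadic)
  have "(2::real) powr 0 < 2 powr (real DIM('a) - a)"
    using assms by (intro powr_less_mono) auto
  then show "(1/2) powr (real DIM('a) - a) < (1::real)"
    by (simp add: powr_divide)
  fix y assume "y \<in> A" "y \<noteq> x"
  with assms have "0 < norm (x - y) / R" "norm (x - y) / R \<le> 1" by (auto simp: dist_norm field_simps)
  from ex_dyadic_scale[OF this] obtain k
    where "(1/2)^k / 2 \<le> norm (x - y) / R" "norm (x - y) / R \<le> (1/2)^k" by blast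
  then show "\<exists>k. R * (1/2)^k / 2 \<le> norm (x - y) \<and> norm (x - y) \<le> R * (1/2)^k"
    using assms(2) by (intro exI[of _ k]) (auto simp: field_simps)
qed (use assms in auto)

lemma nn_integral_norm_powr_far:
  fixes x :: "'a::euclidean_space"
  assumes "a > real DIM('a)" "0 < d" "\<And>y. y \<in> A \<Longrightarrow> d \<le> norm (x - y)"
  shows "(\<integral>\<^sup>+y\<in>A. ennreal (norm (x - y) powr - a) \<partial>lebesgue) \<le>
    ennreal (2 powr \<bar>a\<bar> * unit_ball_vol (real DIM('a)) * (2 * d) powr (real DIM('a) - a) /
      (1 - 2 powr (real DIM('a) - a)))"
proof (rule nn_integral_norm_powr_dyadic)
  have "(2::real) powr (real DIM('a) - a) < 2 powr 0"
    using assms by (intro powr_less_mono) auto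
  then show "2 powr (real DIM('a) - a) < (1::real)"
    by simp
  fix y assume "y \<in> A" "y \<noteq> x"
  with assms have "0 < d / norm (x - y)" "d / norm (x - y) \<le> 1" by (auto simp: field_simps)
  \<comment> \<open>The scale is taken for the reciprocal ratio, so that the shells grow with
    \<open>k\<close>; the starting radius \<open>2 * d\<close> instead of \<open>d\<close> absorbs
    the factor 1/2 of the lower bound.\<close>
  from ex_dyadic_scale[OF this] obtain k
    where k: "(1/2)^k / 2 \<le> d / norm (x - y)" "d / norm (x - y) \<le> (1/2)^k" by blast
  have pos: "norm (x - y) > 0" using \<open>y \<noteq> x\<close> by simp
  have "norm (x - y) \<le> 2 * d * 2^k"
    using k(1) pos by (simp add: power_one_over divide_le_eq le_divide_eq mult.commute)
  moreover have "2 * d * 2^k / 2 \<le> norm (x - y)"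
    using k(2) pos by (simp add: power_one_over divide_le_eq le_divide_eq mult.commute)
  ultimately
  show "\<exists>k. 2 * d * 2^k / 2 \<le> norm (x - y) \<and> norm (x - y) \<le> 2 * d * 2^k"
    by blast
qed (use assms in auto)

section \<open>Balls in the complement of a Lipschitz domain\<close>

text \<open>
  The ball is centred at \<open>x - (r / 2) *\<^sub>R e\<close>; for small \<open>\<eta>\<close> it lies in the cone below \<open>x\<close> that a graph
  with Lipschitz constant \<open>L\<close> cannot enter.
\<close>

lemma lipschitz_boundary_local_corkscrew:
  fixes \<Omega> :: "(real^'n) set"
  assumes "lipschitz_boundary \<Omega>" "x0 \<in> frontier \<Omega>"
  shows "\<exists>\<rho>>0. \<exists>\<eta>>0. \<forall>x\<in>ball x0 \<rho> - \<Omega>. \<forall>r. 0 < r \<longrightarrow> r \<le> \<rho> \<longrightarrow>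
    (\<exists>c. ball c (\<eta> * r) \<subseteq> ball x r - \<Omega>)"
proof -
  obtain e r0 L and g :: "real^'n \<Rightarrow> real" where e: "norm e = 1" and r0: "r0 > 0"
    and lip: "L-lipschitz_on {y. y \<bullet> e = 0} g"
    and graph: "\<Omega> \<inter> ball x0 r0 = {x \<in> ball x0 r0. x \<bullet> e > g (x - (x \<bullet> e) *\<^sub>R e)}"
    using assms unfolding lipschitz_boundary_def by blast
  have L: "L \<ge> 0" using lip by (rule lipschitz_on_nonneg)
  define P where "P x = x - (x \<bullet> e) *\<^sub>R e" for x
  have mem: "z \<in> \<Omega> \<longleftrightarrow> g (P z) < z \<bullet> e" if "z \<in> ball x0 r0" for z
    unfolding P_def using graph that by blast
  have ee: "e \<bullet> e = 1" using e by (simp add: dot_square_norm)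
  have P0: "P x \<bullet> e = 0" for x by (simp add: P_def inner_diff_left ee)
  \<comment> \<open>Chosen so that \<open>(1 + 2 * L) * \<eta> = 1 / 2\<close>: a displacement
    \<open>h\<close> raises the height by at most \<open>norm h\<close> and lowers the graph by at
    most \<open>2 * L * norm h\<close>, and both together must not exceed the descent
    \<open>r / 2\<close>. Being at most 1/2, it also keeps the small ball inside
    \<open>ball x r\<close>.\<close>
  define \<eta> where "\<eta> = 1 / (2 * (1 + 2 * L))"
  have \<eta>: "\<eta> > 0" "\<eta> \<le> 1 / 2" using L by (auto simp: \<eta>_def field_simps)
  \<comment> \<open>Half of \<open>r0\<close> is reserved for the position of \<open>x\<close> and
    half for \<open>r\<close>, so that \<open>ball x r\<close> stays within the chart.\<close>
  have "\<exists>c. ball c (\<eta> * r) \<subseteq> ball x r - \<Omega>"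
    if x: "x \<in> ball x0 (r0 / 2) - \<Omega>" and r: "0 < r" "r \<le> r0 / 2" for x r
  proof (intro exI subsetI)
    fix y assume y: "y \<in> ball (x - (r / 2) *\<^sub>R e) (\<eta> * r)"
    define h where "h = y - (x - (r / 2) *\<^sub>R e)"
    have yh: "y = x - (r / 2) *\<^sub>R e + h" by (simp add: h_def)
    have h: "norm h < \<eta> * r" using y by (simp add: h_def dist_norm norm_minus_commute)
    have "\<eta> * r \<le> 1 / 2 * r" using \<eta> r by (intro mult_right_mono) auto
    then have h2: "norm h < r / 2" using h by simp
    have "dist x y = norm (h - (r / 2) *\<^sub>R e)" by (simp add: dist_norm yh norm_minus_commute algebra_simps)
    also have "\<dots> \<le> norm h + r / 2" using norm_triangle_ineq4[of h "(r / 2) *\<^sub>R e"] e r by simp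
    finally have xy: "dist x y < r" using h2 by simp
    have dx: "dist x0 x < r0 / 2" using x by simp
    have yB: "y \<in> ball x0 r0" using dist_triangle[of x0 y x] xy dx r by simp
    have xB: "x \<in> ball x0 r0" using dx r0 by simp
    with x mem have gx: "x \<bullet> e \<le> g (P x)" by (meson DiffD2 not_less)
    have he: "\<bar>h \<bullet> e\<bar> \<le> norm h" using Cauchy_Schwarz_ineq2[of h e] e by simp
    have "P y - P x = h - (h \<bullet> e) *\<^sub>R e"
      by (simp add: P_def yh inner_add_left inner_diff_left ee algebra_simps)
    then have "norm (P y - P x) \<le> norm h + \<bar>h \<bullet> e\<bar>"
      using norm_triangle_ineq4[of h "(h \<bullet> e) *\<^sub>R e"] e by simp
    with he have "norm (P y - P x) \<le> 2 * norm h" by simp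
    then have "L * norm (P y - P x) \<le> L * (2 * norm h)" using L by (rule mult_left_mono)
    moreover have "\<bar>g (P y) - g (P x)\<bar> \<le> L * norm (P y - P x)"
      using lipschitz_onD[OF lip, of "P y" "P x"] P0 by (simp add: dist_norm)
    ultimately have "g (P y) \<ge> x \<bullet> e - 2 * L * norm h" using gx by linarith
    moreover have "y \<bullet> e \<le> x \<bullet> e - r / 2 + norm h"
      using he by (simp add: yh inner_add_left inner_diff_left ee)
    moreover have "(1 + 2 * L) * norm h \<le> r / 2"
      using h L by (simp add: \<eta>_def field_simps)
    ultimately have "y \<bullet> e \<le> g (P y)" by (simp add: algebra_simps)
    with mem[OF yB] have "y \<notin> \<Omega>" by (simp add: not_less)
    with xy show "y \<in> ball x r - \<Omega>" by simp
  qed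
  then show ?thesis using r0 \<eta>(1) by (intro exI[of _ "r0/2"] conjI exI[of _ \<eta>]) auto
qed

text \<open>By compactness finitely many charts cover the frontier, and the smallest of their radii
  and constants serve at every frontier point. Radii up to an arbitrary \<open>R\<close> are allowed
  because the application has radii up to twice a bound for \<Omega>.\<close>

lemma bounded_lipschitz_domain_exterior_corkscrew:
  fixes \<Omega> :: "(real^'n) set"
  assumes "bounded_lipschitz_domain \<Omega>" "R > 0"
  shows "\<exists>\<eta>>0. \<forall>x\<in>frontier \<Omega>. \<forall>r. 0 < r \<longrightarrow> r \<le> R \<longrightarrow> (\<exists>c. ball c (\<eta> * r) \<subseteq> ball x r - \<Omega>)"
proof (cases "frontier \<Omega> = {}")
  case True
  then show ?thesis by (intro exI[of _ 1]) auto
next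
  case False
  have dom: "open \<Omega>" "bounded \<Omega>" "lipschitz_boundary \<Omega>"
    using assms by (auto simp: bounded_lipschitz_domain_def)
  have notin: "x \<notin> \<Omega>" if "x \<in> frontier \<Omega>" for x
    using that dom(1) by (simp add: frontier_def interior_open)
  obtain \<rho> \<eta> where \<rho>: "\<And>x. x \<in> frontier \<Omega> \<Longrightarrow> \<rho> x > 0" and \<eta>: "\<And>x. x \<in> frontier \<Omega> \<Longrightarrow> \<eta> x > 0"
    and cork: "\<And>x0 x r. x0 \<in> frontier \<Omega> \<Longrightarrow> x \<in> ball x0 (\<rho> x0) - \<Omega> \<Longrightarrow> 0 < r \<Longrightarrow> r \<le> \<rho> x0 \<Longrightarrow>
       \<exists>c. ball c (\<eta> x0 * r) \<subseteq> ball x r - \<Omega>"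
    using lipschitz_boundary_local_corkscrew[OF dom(3)] by metis
  have "compact (frontier \<Omega>)" using dom(2) by (rule compact_frontier_bounded)
  then obtain T where T: "T \<subseteq> frontier \<Omega>" "finite T" and cov: "frontier \<Omega> \<subseteq> (\<Union>x\<in>T. ball x (\<rho> x))"
    using compactE_image[of "frontier \<Omega>" "frontier \<Omega>" "\<lambda>x. ball x (\<rho> x)"] \<rho>
    by (metis (no_types, lifting) UN_I centre_in_ball open_ball subsetI)
  have "T \<noteq> {}" using cov False by auto
  define \<rho>m \<eta>m where "\<rho>m = Min (\<rho> ` T)" and "\<eta>m = Min (\<eta> ` T)"
  have pos: "\<rho>m > 0" "\<eta>m > 0"
    using T \<open>T \<noteq> {}\<close> \<rho> \<eta> by (auto simp: \<rho>m_def \<eta>m_def)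
  have le: "\<rho>m \<le> \<rho> x" "\<eta>m \<le> \<eta> x" if "x \<in> T" for x
    using T that by (auto simp: \<rho>m_def \<eta>m_def)
  \<comment> \<open>The charts only reach radius \<open>\<rho>m\<close>. For larger \<open>r\<close>
    the ball found at radius \<open>\<rho>m\<close> is reused, and since \<open>r \<le> R\<close>
    the factor \<open>\<rho>m / R\<close> makes up for the difference.\<close>
  define \<kappa> where "\<kappa> = \<eta>m * min 1 (\<rho>m / R)"
  have "\<exists>c. ball c (\<kappa> * r) \<subseteq> ball x r - \<Omega>" if x: "x \<in> frontier \<Omega>" and r: "0 < r" "r \<le> R" for x r
  proof -
    obtain x0 where x0: "x0 \<in> T" "x \<in> ball x0 (\<rho> x0)" using cov x by auto
    define r' where "r' = min r \<rho>m"
    have r': "0 < r'" "r' \<le> \<rho> x0" "r' \<le> r" using r pos le[OF x0(1)] by (auto simp: r'_def)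
    have "min 1 (\<rho>m / R) * r \<le> r'"
    proof -
      have "(\<rho>m / R) * r \<le> \<rho>m" using r pos assms(2) by (simp add: field_simps)
      moreover have "min 1 (\<rho>m / R) * r \<le> 1 * r" "min 1 (\<rho>m / R) * r \<le> (\<rho>m / R) * r"
        using r by (intro mult_right_mono; simp)+
      ultimately show ?thesis by (simp add: r'_def)
    qed
    then have "\<kappa> * r \<le> \<eta>m * r'" using pos by (simp add: \<kappa>_def mult.assoc)
    also have "\<dots> \<le> \<eta> x0 * r'" using le[OF x0(1)] r' by (intro mult_right_mono) auto
    finally have k: "\<kappa> * r \<le> \<eta> x0 * r'" .
    obtain c where "ball c (\<eta> x0 * r') \<subseteq> ball x r' - \<Omega>"
      using cork[of x0 x r'] x0 T notin[OF x] r' by blast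
    moreover have "ball c (\<kappa> * r) \<subseteq> ball c (\<eta> x0 * r')" "ball x r' \<subseteq> ball x r"
      using k r' by (auto intro: subset_ball)
    ultimately show ?thesis by blast
  qed
  moreover have "\<kappa> > 0" using pos assms(2) by (simp add: \<kappa>_def)
  ultimately show ?thesis by blast
qed

section \<open>Extension of Hoelder functions\<close>

text \<open>The fractions of \<open>a\<close> and \<open>b\<close> in \<open>a + b\<close> lie
  between 0 and 1, so raising them to a power \<open>t \<le> 1\<close> does not decrease them, and
  they add up to 1.\<close>

lemma powr_add_le_add_powr:
  fixes a b t :: real
  assumes "0 \<le> a" "0 \<le> b" "0 < t" "t \<le> 1"
  shows "(a + b) powr t \<le> a powr t + b powr t"
proof (cases "a + b = 0")
  case False
  then have s: "a + b > 0" using assms by simp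
  have *: "u / (a + b) * (a + b) powr t \<le> u powr t" if "0 \<le> u" "u \<le> a + b" for u
  proof (cases "u = 0")
    case False
    then have "u / (a + b) = (u / (a + b)) powr 1" using s that by simp
    also have "\<dots> \<le> (u / (a + b)) powr t"
      using s that False assms by (intro powr_mono') auto
    finally show ?thesis using s that by (simp add: powr_divide field_simps)
  qed simp
  have "(a + b) powr t = a / (a + b) * (a + b) powr t + b / (a + b) * (a + b) powr t"
    using s by (simp flip: distrib_right add_divide_distrib)
  also have "\<dots> \<le> a powr t + b powr t"
    using assms by (intro add_mono *) auto
  finally show ?thesis .
qed (use assms in auto)

text \<open>For \<open>t \<le> 1\<close> the quantity \<open>norm (x - y) powr t\<close> is itself a
  metric, and being Hoelder means being Lipschitz for it; hence the extension keeps the constant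
  \<open>M\<close>.\<close>

lemma holder_extension_real:
  fixes f :: "'a::real_normed_vector \<Rightarrow> real"
  assumes "E \<noteq> {}" "0 < t" "t \<le> 1" "0 \<le> M"
    and f: "\<And>x y. x \<in> E \<Longrightarrow> y \<in> E \<Longrightarrow> \<bar>f x - f y\<bar> \<le> M * norm (x - y) powr t"
  obtains F where "\<And>x. x \<in> E \<Longrightarrow> F x = f x" "\<And>x y. \<bar>F x - F y\<bar> \<le> M * norm (x - y) powr t"
proof
  \<comment> \<open>McShane's formula\<close>
  define F where "F x = (INF y\<in>E. f y + M * norm (x - y) powr t)" for x
  have tri: "M * norm (x - z) powr t \<le> M * norm (x - y) powr t + M * norm (y - z) powr t" for x y z
  proof -
    have "norm (x - z) powr t \<le> (norm (x - y) + norm (y - z)) powr t"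
      using assms norm_triangle_ineq[of "x - y" "y - z"] by (intro powr_mono2) auto
    also have "\<dots> \<le> norm (x - y) powr t + norm (y - z) powr t"
      using assms by (intro powr_add_le_add_powr) auto
    finally show ?thesis using assms(4) by (metis distrib_left mult_left_mono)
  qed
  have low: "f z - M * norm (x - z) powr t \<le> f y + M * norm (x - y) powr t" if "y \<in> E" "z \<in> E" for x y z
    using f[OF that] tri[of y z x] by (simp add: norm_minus_commute)
  \<comment> \<open>Any fixed point of \<open>E\<close> supplies a lower bound through
    \<open>low\<close>.\<close>
  have bdd: "bdd_below ((\<lambda>y. f y + M * norm (x - y) powr t) ` E)" for x
    using assms(1) low by (meson bdd_belowI2 ex_in_conv)
  show "F x = f x" if "x \<in> E" for x
  proof (rule antisym)
    show "F x \<le> f x" unfolding F_def using cINF_lower[OF bdd that, of x] assms by simp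
    show "f x \<le> F x" unfolding F_def
    proof (rule cINF_greatest[OF assms(1)])
      fix y assume "y \<in> E"
      then show "f x \<le> f y + M * norm (x - y) powr t" using f[OF that, of y] by linarith
    qed
  qed
  have *: "F x \<le> F y + M * norm (x - y) powr t" for x y
  proof -
    have "F x - M * norm (x - y) powr t \<le> F y" unfolding F_def[of y]
    proof (rule cINF_greatest[OF assms(1)])
      fix z assume z: "z \<in> E"
      have "F x \<le> f z + M * norm (x - z) powr t" unfolding F_def by (rule cINF_lower[OF bdd z])
      with tri[of x z y] show "F x - M * norm (x - y) powr t \<le> f z + M * norm (y - z) powr t" by simp
    qed
    then show ?thesis by simp
  qed
  show "\<bar>F x - F y\<bar> \<le> M * norm (x - y) powr t" for x y
    using *[of x y] *[of y x] by (simp add: abs_le_iff norm_minus_commute)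
qed

text \<open>The coordinates are extended separately; bounding the Euclidean norm by the sum of the
  coordinates costs the factor \<open>CARD('m)\<close>.\<close>

lemma holder_extension_vec:
  fixes f :: "'a::real_normed_vector \<Rightarrow> real^'m"
  assumes "E \<noteq> {}" "0 < t" "t \<le> 1" "0 \<le> M"
    and f: "\<And>x y. x \<in> E \<Longrightarrow> y \<in> E \<Longrightarrow> norm (f x - f y) \<le> M * norm (x - y) powr t"
  obtains F where "\<And>x. x \<in> E \<Longrightarrow> F x = f x"
    "\<And>x y. norm (F x - F y) \<le> real CARD('m) * M * norm (x - y) powr t"
proof -
  have "\<exists>F. (\<forall>x\<in>E. F x = f x $ i) \<and> (\<forall>x y. \<bar>F x - F y\<bar> \<le> M * norm (x - y) powr t)" for i
  proof -
    have "\<bar>f x $ i - f y $ i\<bar> \<le> M * norm (x - y) powr t" if "x \<in> E" "y \<in> E" for x y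
      using f[OF that] component_le_norm_cart[of "f x - f y" i] by simp
    then show ?thesis using holder_extension_real[OF assms(1-4), of "\<lambda>x. f x $ i"] by metis
  qed
  then obtain F where F: "\<And>i x. x \<in> E \<Longrightarrow> F i x = f x $ i"
    "\<And>i x y. \<bar>F i x - F i y\<bar> \<le> M * norm (x - y) powr t" by metis
  show thesis
  proof
    show "(\<chi> i. F i x) = f x" if "x \<in> E" for x using F(1)[OF that] by (simp add: vec_eq_iff)
    show "norm ((\<chi> i. F i x) - (\<chi> i. F i y)) \<le> real CARD('m) * M * norm (x - y) powr t" for x y
    proof -
      have "norm ((\<chi> i. F i x) - (\<chi> i. F i y)) \<le> (\<Sum>i\<in>UNIV. \<bar>F i x - F i y\<bar>)"
        using norm_le_l1_cart[of "(\<chi> i. F i x) - (\<chi> i. F i y)"] by simp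
      also have "\<dots> \<le> (\<Sum>i\<in>(UNIV::'m set). M * norm (x - y) powr t)" by (intro sum_mono F)
      finally show ?thesis by simp
    qed
  qed
qed

section \<open>Hoelder functions with bounded support\<close>

lemma set_integrable_bounded_lebesgue:
  fixes f :: "'a::euclidean_space \<Rightarrow> 'b::{banach, second_countable_topology}"
  assumes "f \<in> borel_measurable lebesgue" "S \<in> lmeasurable" "\<And>x. norm (f x) \<le> B"
  shows "set_integrable lebesgue S f"
  unfolding set_integrable_def
  using assms by (intro integrableI_bounded_set_indicator[where B = B]) (auto simp: fmeasurable_def)

lemma holder_imp_continuous:
  fixes v :: "'a::real_normed_vector \<Rightarrow> 'b::real_normed_vector"
  assumes "0 < t" and h: "\<And>x y. norm (v x - v y) \<le> M * norm (x - y) powr t"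
  shows "continuous_on UNIV v"
proof -
  have "(v \<longlongrightarrow> v x) (at x)" for x
  proof -
    have "((\<lambda>y. M * norm (y - x) powr t) \<longlongrightarrow> M * 0) (at x)"
      using assms(1)
      by (intro tendsto_mult tendsto_const tendsto_zero_powrI tendsto_norm_zero LIM_zero tendsto_ident_at)
        auto
    then have lim: "((\<lambda>y. M * norm (y - x) powr t) \<longlongrightarrow> 0) (at x)" by (simp only: mult_zero_right)
    have "\<forall>\<^sub>F y in at x. norm (v y - v x) \<le> M * norm (y - x) powr t"
      by (intro always_eventually allI h)
    then have "((\<lambda>y. v y - v x) \<longlongrightarrow> 0) (at x)"
      using lim by (rule Lim_null_comparison)
    then show ?thesis by (rule LIM_zero_cancel)
  qed
  then show ?thesis by (simp add: continuous_on_def)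
qed

lemma holder_bounded_support_imp_bounded:
  fixes v :: "'a::euclidean_space \<Rightarrow> 'b::real_normed_vector"
  assumes "0 < t" "\<And>x y. norm (v x - v y) \<le> M * norm (x - y) powr t"
    and "bounded \<Omega>" "\<And>x. x \<notin> \<Omega> \<Longrightarrow> v x = 0"
  shows "bounded (range v)"
proof -
  have "continuous_on (closure \<Omega>) v"
    using holder_imp_continuous[OF assms(1,2)] continuous_on_subset by blast
  then have "compact (v ` closure \<Omega>)"
    using assms(3) by (intro compact_continuous_image) (auto simp: compact_closure)
  then have "bounded (insert 0 (v ` closure \<Omega>))"
    by (simp add: compact_imp_bounded)
  moreover have "range v \<subseteq> insert 0 (v ` closure \<Omega>)"
    using assms(4) closure_subset by fastforce
  ultimately show ?thesis using bounded_subset by blast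
qed

lemma holder_seminorm_le:
  assumes "\<And>x y. norm (v x - v y) \<le> M * norm (x - y) powr t"
  shows "holder_seminorm t A v \<le> ennreal M"
  unfolding holder_seminorm_def
proof (rule SUP_least, clarify)
  fix x y :: "real^'a" assume "x \<noteq> y"
  then show "ennreal (norm (v x - v y) / norm (x - y) powr t) \<le> ennreal M"
    using assms[of x y] by (intro ennreal_leI) (simp add: divide_le_eq)
qed

text \<open>The Hoelder bound cancels part of the kernel and leaves the exponent
  \<open>a = n - p * (t - t')\<close>, where n is the dimension. Since \<open>t' < t\<close> this is
  below n, so the singularity on the diagonal is integrable, uniformly in \<open>x\<close> on a
  bounded set.\<close>

lemma holder_gagliardo_energy_finite:
  fixes v :: "real^'n \<Rightarrow> real^'m"
  assumes "t' < t" "1 \<le> p" "0 \<le> M"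
    and h: "\<And>x y. norm (v x - v y) \<le> M * norm (x - y) powr t"
    and A: "bounded A" "A \<in> sets borel"
  shows "gagliardo_energy t' p A v < \<infinity>"
proof -
  obtain D where D: "D > 0" "\<And>x. x \<in> A \<Longrightarrow> A \<subseteq> cball x D"
  proof -
    obtain R where R: "R > 0" "\<And>x. x \<in> A \<Longrightarrow> norm x \<le> R" using A(1) bounded_pos by metis
    have "A \<subseteq> cball x (2 * R)" if "x \<in> A" for x
    proof
      fix y assume "y \<in> A"
      then show "y \<in> cball x (2 * R)"
        using R(2)[OF that] R(2)[of y] norm_triangle_ineq4[of x y] by (simp add: dist_norm)
    qed
    then show thesis using that[of "2 * R"] R(1) by simp
  qed
  define a where "a = real CARD('n) - p * (t - t')"
  have a: "a < real DIM(real^'n)" using assms by (simp add: a_def)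
  define C where "C = 2 powr \<bar>a\<bar> * unit_ball_vol (real DIM(real^'n)) * D powr (real DIM(real^'n) - a) /
      (1 - (1/2) powr (real DIM(real^'n) - a))"
  have k: "norm (v x - v y) powr p / norm (x - y) powr (real CARD('n) + p * t')
      \<le> M powr p * norm (x - y) powr - a" for x y
  proof (cases "x = y")
    case False
    have "norm (v x - v y) powr p \<le> (M * norm (x - y) powr t) powr p"
      using assms h by (intro powr_mono2) auto
    also have "\<dots> = M powr p * norm (x - y) powr (t * p)"
      using assms by (simp add: powr_mult powr_powr)
    finally have "norm (v x - v y) powr p / norm (x - y) powr (real CARD('n) + p * t')
      \<le> M powr p * norm (x - y) powr (t * p) / norm (x - y) powr (real CARD('n) + p * t')"
      by (rule divide_right_mono) simp
    also have "\<dots> = M powr p * norm (x - y) powr (t * p - (real CARD('n) + p * t'))"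
      by (simp add: powr_diff)
    also have "t * p - (real CARD('n) + p * t') = - a" by (simp add: a_def algebra_simps)
    finally show ?thesis .
  qed simp
  have inner: "(\<integral>\<^sup>+y\<in>A. ennreal (norm (v x - v y) powr p / norm (x - y) powr (real CARD('n) + p * t')) \<partial>lebesgue)
     \<le> ennreal (M powr p) * ennreal C" if "x \<in> A" for x
  proof -
    have [measurable]: "A \<in> sets borel" by fact
    have "(\<integral>\<^sup>+y\<in>A. ennreal (norm (v x - v y) powr p / norm (x - y) powr (real CARD('n) + p * t')) \<partial>lebesgue)
      \<le> (\<integral>\<^sup>+y. ennreal (M powr p) * (ennreal (norm (x - y) powr - a) * indicator A y) \<partial>lebesgue)"
      using k by (intro nn_integral_mono) (auto simp: indicator_def ennreal_mult'[symmetric] intro!: ennreal_leI)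
    also have "\<dots> = ennreal (M powr p) * (\<integral>\<^sup>+y\<in>A. ennreal (norm (x - y) powr - a) \<partial>lebesgue)"
      by (intro nn_integral_cmult measurable_completion) measurable
    also have "\<dots> \<le> ennreal (M powr p) * ennreal C"
      unfolding C_def by (intro mult_left_mono nn_integral_norm_powr_near a D that) auto
    finally show ?thesis .
  qed
  have "gagliardo_energy t' p A v \<le> (\<integral>\<^sup>+x. ennreal (M powr p) * ennreal C * indicator A x \<partial>lebesgue)"
    unfolding gagliardo_energy_def using inner by (intro nn_integral_mono) (auto simp: indicator_def)
  also have "\<dots> = ennreal (M powr p) * ennreal C * emeasure lborel A"
    using A(2) by (subst nn_integral_cmult_indicator) auto
  also have "\<dots> < \<infinity>"
    using emeasure_bounded_finite[OF A(1)] by (simp add: ennreal_mult_less_top)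
  finally show ?thesis .
qed

lemma holder_bounded_support_imp_X0:
  fixes v :: "real^'n \<Rightarrow> real^'m"
  assumes "0 < t" "t' < t" "1 \<le> p" "0 \<le> M"
    and h: "\<And>x y. norm (v x - v y) \<le> M * norm (x - y) powr t"
    and \<Omega>: "bounded \<Omega>" "\<And>x. x \<notin> \<Omega> \<Longrightarrow> v x = 0" and \<Omega>': "open \<Omega>'" "bounded \<Omega>'"
  shows "v \<in> X0_space s t' p \<Omega> \<Omega>'"
proof -
  obtain B where B: "\<And>x. norm (v x) \<le> B"
    using holder_bounded_support_imp_bounded[OF assms(1) h \<Omega>] by (auto simp: bounded_iff)
  have vb[measurable]: "v \<in> borel_measurable borel"
    using holder_imp_continuous[OF assms(1) h] by (rule borel_measurable_continuous_onI)
  then have vm: "v \<in> borel_measurable lebesgue" by (simp add: measurable_completion)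
  have lm: "\<Omega>' \<in> lmeasurable" using \<Omega>' by (simp add: lmeasurable_open)
  have "v \<in> Lp_space p \<Omega>'"
  proof -
    have "norm (norm (v x) powr p) \<le> B powr p" for x
      using B assms by (auto intro!: powr_mono2)
    then have "set_integrable lebesgue \<Omega>' (\<lambda>x. norm (v x) powr p)"
      by (intro set_integrable_bounded_lebesgue[OF _ lm] measurable_completion) measurable
    then show ?thesis using vm by (simp add: Lp_space_def measurable_restrict_space1)
  qed
  moreover have "gagliardo_energy t' p \<Omega>' v < \<infinity>"
    using holder_gagliardo_energy_finite[OF assms(2-4) h] \<Omega>' by simp
  moreover have "v \<in> L1_tail s"
  proof -
    have "v absolutely_integrable_on K" if "compact K" for K
      using that B by (intro set_integrable_bounded_lebesgue[OF vm]) (auto simp: lmeasurable_compact)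
    moreover
    define \<phi> where "\<phi> x = norm (v x) / (1 + norm x powr (real CARD('n) + 2 * s))" for x
    have "norm (\<phi> x) \<le> B" for x
    proof -
      have "norm (v x) \<le> B * (1 + norm x powr (real CARD('n) + 2 * s))"
        using B[of x] mult_left_mono[of 1 "1 + norm x powr (real CARD('n) + 2 * s)" B]
          norm_ge_zero[of "v x"] by simp
      then show ?thesis by (simp add: \<phi>_def divide_le_eq add_pos_nonneg)
    qed
    moreover have "\<phi> \<in> borel_measurable lebesgue"
      unfolding \<phi>_def by (intro measurable_completion) measurable
    \<comment> \<open>Nothing is assumed here on the measurability of \<Omega>; its closure is
      compact, and \<open>\<phi>\<close> still vanishes outside it.\<close>
    ultimately have "set_integrable lebesgue (closure \<Omega>) \<phi>"
      using \<Omega>(1) by (intro set_integrable_bounded_lebesgue[where B = B]) (auto simp: lmeasurable_compact compact_closure)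
    moreover have "(\<lambda>x. indicator (closure \<Omega>) x *\<^sub>R \<phi> x) = \<phi>"
      using \<Omega>(2) closure_subset[of \<Omega>] by (fastforce simp: indicator_def \<phi>_def)
    ultimately have "integrable lebesgue \<phi>"
      unfolding set_integrable_def by (simp only:)
    then show ?thesis
      using \<open>\<And>K. compact K \<Longrightarrow> v absolutely_integrable_on K\<close> by (simp add: L1_tail_def \<phi>_def[abs_def])
  qed
  ultimately show ?thesis using \<Omega>(2) by (simp add: X0_space_def frac_sobolev_def)
qed

section \<open>Pointwise bounds by averaging\<close>

text \<open>On \<open>S\<close> the denominator of the density is at most
  \<open>r powr (real CARD('n) + p * t)\<close>, so multiplying by this bound removes it.\<close>

lemma nn_integral_norm_diff_powr_le_frac_density:
  fixes w :: "real^'n \<Rightarrow> real^'m"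
  assumes w: "w \<in> borel_measurable lebesgue" and "0 \<le> t" "1 \<le> p" "0 < r" "S \<subseteq> cball x r"
  shows "(\<integral>\<^sup>+z\<in>S. ennreal (norm (w x - w z) powr p) \<partial>lebesgue) \<le>
    ennreal (r powr (real CARD('n) + p * t)) * frac_density t p UNIV w x"
proof -
  define a where "a = real CARD('n) + p * t"
  have a: "a \<ge> 0" using assms by (simp add: a_def)
  have [measurable]: "w \<in> borel_measurable lebesgue" "(\<lambda>z. z) \<in> borel_measurable lebesgue"
    using w by (auto intro: measurable_completion)
  have "(\<integral>\<^sup>+z\<in>S. ennreal (norm (w x - w z) powr p) \<partial>lebesgue) \<le>
    (\<integral>\<^sup>+z. ennreal (r powr a) * ennreal (norm (w x - w z) powr p / norm (x - z) powr a) \<partial>lebesgue)"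
  proof (rule nn_integral_mono)
    fix z
    show "ennreal (norm (w x - w z) powr p) * indicator S z
      \<le> ennreal (r powr a) * ennreal (norm (w x - w z) powr p / norm (x - z) powr a)"
    proof (cases "z \<in> S \<and> z \<noteq> x")
      case True
      then have "norm (x - z) powr a \<le> r powr a"
        using assms a by (intro powr_mono2) (auto simp: dist_norm)
      then have "norm (x - z) powr a * (norm (w x - w z) powr p / norm (x - z) powr a)
        \<le> r powr a * (norm (w x - w z) powr p / norm (x - z) powr a)"
        by (rule mult_right_mono) simp
      moreover have "norm (x - z) powr a * (norm (w x - w z) powr p / norm (x - z) powr a) =
        norm (w x - w z) powr p"
        using True by simp
      ultimately have "norm (w x - w z) powr p \<le> r powr a * (norm (w x - w z) powr p / norm (x - z) powr a)"
        by linarith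
      from ennreal_leI[OF this] show ?thesis
        using True by (simp only: ennreal_mult' powr_ge_zero indicator_simps mult_1_right)
    next
      case False
      \<comment> \<open>At \<open>z = x\<close> the denominator cannot be cancelled, but there the
        left side is \<open>0 powr p = 0\<close>.\<close>
      then show ?thesis by (cases "z = x") simp_all
    qed
  qed
  also have "\<dots> = ennreal (r powr a) * frac_density t p UNIV w x"
    unfolding frac_density_def a_def by (subst nn_integral_cmult) simp_all
  finally show ?thesis by (simp add: a_def)
qed

lemma emeasure_lebesgue_ball:
  fixes c :: "real^'n"
  assumes "r \<ge> 0"
  shows "emeasure lebesgue (ball c r) = ennreal (unit_ball_vol (real CARD('n)) * r ^ CARD('n))"
  using assms by (subst emeasure_completion) (simp_all add: emeasure_ball)

lemma add_powr_le:
  fixes a b p :: real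
  assumes "0 \<le> a" "0 \<le> b" "0 \<le> p"
  shows "(a + b) powr p \<le> 2 powr p * (a powr p + b powr p)"
proof -
  have "(a + b) powr p \<le> (2 * max a b) powr p"
    using assms by (intro powr_mono2) auto
  also have "\<dots> = 2 powr p * max a b powr p" using assms by (simp add: powr_mult)
  also have "\<dots> \<le> 2 powr p * (a powr p + b powr p)"
    by (intro mult_left_mono) (auto simp: max_def)
  finally show ?thesis .
qed

text \<open>The ball around the midpoint lies within distance \<open>r = norm (x - y)\<close> of
  both endpoints, so each average costs \<open>r powr (n + p * t) * K\<close> with n the dimension.
  The volume is a multiple of \<open>r ^ n\<close>, and the quotient leaves
  \<open>r powr (p * t)\<close>. The bound holds at every pair of points with low density, without
  passing to Lebesgue points.\<close>

lemma norm_diff_powr_le_of_frac_density: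
  fixes w :: "real^'n \<Rightarrow> real^'m"
  assumes w: "w \<in> borel_measurable lebesgue" and "0 \<le> t" "1 \<le> p" "0 \<le> K"
    and "frac_density t p UNIV w x \<le> ennreal K" "frac_density t p UNIV w y \<le> ennreal K"
  shows "norm (w x - w y) powr p \<le>
    2 * 2 powr p * 2 ^ CARD('n) / unit_ball_vol (real CARD('n)) * K * norm (x - y) powr (p * t)"
proof (cases "x = y")
  case False
  define r where "r = norm (x - y)"
  have r: "r > 0" using False by (simp add: r_def)
  define m where "m = midpoint x y"
  define S where "S = ball m (r / 2)"
  have S: "S \<subseteq> cball u r" if "dist u m = r / 2" for u
  proof
    fix z assume "z \<in> S"
    then show "z \<in> cball u r" using dist_triangle[of u z m] that by (simp add: S_def)
  qed
  have Sx: "S \<subseteq> cball x r" and Sy: "S \<subseteq> cball y r"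
    by (rule S, simp only: m_def r_def dist_midpoint dist_norm[symmetric])+
  define a where "a = real CARD('n) + p * t"
  define D where "D = norm (w x - w y) powr p"
  define I where "I u = (\<integral>\<^sup>+z\<in>S. ennreal (norm (w u - w z) powr p) \<partial>lebesgue)" for u
  have [measurable]: "w \<in> borel_measurable lebesgue" "S \<in> sets lebesgue"
    using w by (auto simp: S_def)
  have I: "I u \<le> ennreal (r powr a * K)" if "S \<subseteq> cball u r" "frac_density t p UNIV w u \<le> ennreal K" for u
  proof -
    have "I u \<le> ennreal (r powr a) * frac_density t p UNIV w u"
      unfolding I_def a_def
      by (rule nn_integral_norm_diff_powr_le_frac_density[OF w assms(2,3) r that(1)])
    also have "\<dots> \<le> ennreal (r powr a) * ennreal K" by (intro mult_left_mono that) simp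
    finally show ?thesis by (simp add: ennreal_mult'[symmetric])
  qed
  have pt: "D \<le> 2 powr p * (norm (w x - w z) powr p + norm (w y - w z) powr p)" for z
  proof -
    have "norm (w x - w y) \<le> norm (w x - w z) + norm (w y - w z)"
      using norm_triangle_ineq4[of "w x - w z" "w y - w z"] by simp
    then have "D \<le> (norm (w x - w z) + norm (w y - w z)) powr p"
      unfolding D_def using assms by (intro powr_mono2) auto
    also have "\<dots> \<le> 2 powr p * (norm (w x - w z) powr p + norm (w y - w z) powr p)"
      using assms by (intro add_powr_le) auto
    finally show ?thesis .
  qed
  have D: "D \<ge> 0" by (simp add: D_def)
  have "ennreal (D * (unit_ball_vol (real CARD('n)) * (r / 2) ^ CARD('n))) = ennreal D * emeasure lebesgue S"
    unfolding S_def using r D by (subst emeasure_lebesgue_ball) (simp_all add: ennreal_mult')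
  also have "\<dots> = (\<integral>\<^sup>+z. ennreal D * indicator S z \<partial>lebesgue)"
    by (rule nn_integral_cmult_indicator[symmetric]) simp
  also have "\<dots> \<le> (\<integral>\<^sup>+z. ennreal (2 powr p) * (ennreal (norm (w x - w z) powr p) * indicator S z
       + ennreal (norm (w y - w z) powr p) * indicator S z) \<partial>lebesgue)"
  proof (rule nn_integral_mono)
    fix z
    have "ennreal D \<le> ennreal (2 powr p * (norm (w x - w z) powr p + norm (w y - w z) powr p))"
      using pt by (rule ennreal_leI)
    also have "\<dots> = ennreal (2 powr p) * (ennreal (norm (w x - w z) powr p) + ennreal (norm (w y - w z) powr p))"
      by (simp add: ennreal_mult')
    finally show "ennreal D * indicator S z \<le> ennreal (2 powr p) *
        (ennreal (norm (w x - w z) powr p) * indicator S z + ennreal (norm (w y - w z) powr p) * indicator S z)"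
      by (cases "z \<in> S") simp_all
  qed
  also have "\<dots> = ennreal (2 powr p) * (I x + I y)"
  proof -
    have "(\<integral>\<^sup>+z. ennreal (norm (w x - w z) powr p) * indicator S z
       + ennreal (norm (w y - w z) powr p) * indicator S z \<partial>lebesgue) = I x + I y"
      unfolding I_def by (rule nn_integral_add) measurable
    then show ?thesis by (subst nn_integral_cmult) simp_all
  qed
  also have "\<dots> \<le> ennreal (2 powr p) * (ennreal (r powr a * K) + ennreal (r powr a * K))"
    by (intro mult_left_mono add_mono I Sx Sy assms) simp
  also have "\<dots> = ennreal (2 powr p * (r powr a * K + r powr a * K))"
  proof -
    have "0 \<le> r powr a * K" using assms(4) by simp
    then show ?thesis by (simp only: ennreal_mult'[OF powr_ge_zero] ennreal_plus)
  qed
  finally have "D * (unit_ball_vol (real CARD('n)) * (r / 2) ^ CARD('n)) \<le> 2 powr p * (r powr a * K + r powr a * K)"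
    using assms(4) by (subst (asm) ennreal_le_iff) simp_all
  moreover have "r powr a = r ^ CARD('n) * r powr (p * t)"
    using r by (simp add: a_def powr_add powr_realpow)
  ultimately have "(D * unit_ball_vol (real CARD('n))) * r ^ CARD('n) \<le>
      (2 * 2 powr p * 2 ^ CARD('n) * K * r powr (p * t)) * r ^ CARD('n)"
    by (simp add: power_divide field_simps)
  then have "D * unit_ball_vol (real CARD('n)) \<le> 2 * 2 powr p * 2 ^ CARD('n) * K * r powr (p * t)"
    using r by (subst (asm) mult_le_cancel_right) auto
  then show ?thesis
    by (simp add: D_def r_def le_divide_eq)
qed simp

text \<open>One-sided version of the averaging: where \<open>w z = 0\<close>, the difference
  \<open>w x - w z\<close> is \<open>w x\<close> itself, so the density at \<open>x\<close> alone
  suffices.\<close>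

lemma norm_powr_le_of_frac_density_of_zero_ball:
  fixes w :: "real^'n \<Rightarrow> real^'m"
  assumes w: "w \<in> borel_measurable lebesgue" and "0 \<le> t" "1 \<le> p" "0 \<le> K" "0 < r" "0 < \<eta>"
    and G: "frac_density t p UNIV w x \<le> ennreal K"
    and S: "ball c (\<eta> * r) \<subseteq> cball x (2 * r)" and zero: "\<And>z. z \<in> ball c (\<eta> * r) \<Longrightarrow> w z = 0"
  shows "norm (w x) powr p \<le>
    2 powr (real CARD('n) + p * t) / (unit_ball_vol (real CARD('n)) * \<eta> ^ CARD('n)) * K * r powr (p * t)"
proof -
  define a where "a = real CARD('n) + p * t"
  define D where "D = norm (w x) powr p"
  have D: "D \<ge> 0" by (simp add: D_def)
  have "ennreal (D * (unit_ball_vol (real CARD('n)) * (\<eta> * r) ^ CARD('n))) =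
      ennreal D * emeasure lebesgue (ball c (\<eta> * r))"
    using assms(5,6) D by (subst emeasure_lebesgue_ball) (simp_all add: ennreal_mult')
  also have "\<dots> = (\<integral>\<^sup>+z. ennreal D * indicator (ball c (\<eta> * r)) z \<partial>lebesgue)"
    by (rule nn_integral_cmult_indicator[symmetric]) simp
  also have "\<dots> = (\<integral>\<^sup>+z\<in>ball c (\<eta> * r). ennreal (norm (w x - w z) powr p) \<partial>lebesgue)"
    using zero by (intro nn_integral_cong) (auto simp: indicator_def D_def)
  also have "\<dots> \<le> ennreal ((2 * r) powr a) * frac_density t p UNIV w x"
    unfolding a_def using assms by (intro nn_integral_norm_diff_powr_le_frac_density) auto
  also have "\<dots> \<le> ennreal ((2 * r) powr a) * ennreal K"
    by (intro mult_left_mono G) simp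
  finally have "D * (unit_ball_vol (real CARD('n)) * (\<eta> * r) ^ CARD('n)) \<le> (2 * r) powr a * K"
    using assms by (simp add: ennreal_mult'[symmetric])
  moreover have "(2 * r) powr a = 2 powr a * (r ^ CARD('n) * r powr (p * t))"
    using assms by (simp add: a_def powr_mult powr_add powr_realpow)
  ultimately have "(D * (unit_ball_vol (real CARD('n)) * \<eta> ^ CARD('n))) * r ^ CARD('n)
     \<le> (2 powr a * K * r powr (p * t)) * r ^ CARD('n)"
    by (simp add: power_mult_distrib ac_simps)
  then have "D * (unit_ball_vol (real CARD('n)) * \<eta> ^ CARD('n)) \<le> 2 powr a * K * r powr (p * t)"
    using assms(5) by (subst (asm) mult_le_cancel_right) auto
  then show ?thesis
    using assms(6) by (simp add: D_def a_def le_divide_eq)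
qed

lemma le_of_powr_le:
  fixes p t :: real
  assumes "1 \<le> p" "0 \<le> N" "0 \<le> C" "0 < lam" "0 \<le> r"
    and "N powr p \<le> C * lam powr p * r powr (p * t)"
  shows "N \<le> C powr (1 / p) * lam * r powr t"
proof -
  have "(N powr p) powr (1 / p) \<le> (C * lam powr p * r powr (p * t)) powr (1 / p)"
    using assms by (intro powr_mono2) auto
  then show ?thesis using assms by (simp add: powr_powr powr_mult)
qed

text \<open>\<open>M\<close> is fixed before \<open>w\<close> and \<open>lam\<close>: it is built
  from the volume of the unit ball, \<open>t\<close>, \<open>p\<close> and the constant of the
  exterior balls of \<Omega>.\<close>

lemma holder_on_low_frac_density:
  fixes \<Omega> :: "(real^'n) set"
  assumes dom: "bounded_lipschitz_domain \<Omega>" and "0 \<le> t" "1 \<le> p"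
  shows "\<exists>M>0. \<forall>(w :: real^'n \<Rightarrow> real^'m) lam. w \<in> borel_measurable lebesgue \<longrightarrow> 0 < lam \<longrightarrow>
    (\<forall>x. x \<notin> \<Omega> \<longrightarrow> w x = 0) \<longrightarrow>
    (\<forall>x \<in> - \<Omega> \<union> {x. frac_density t p UNIV w x \<le> ennreal (lam powr p)}.
     \<forall>y \<in> - \<Omega> \<union> {x. frac_density t p UNIV w x \<le> ennreal (lam powr p)}.
       norm (w x - w y) \<le> M * lam * norm (x - y) powr t)"
proof -
  obtain B where B: "B > 0" "\<And>x. x \<in> closure \<Omega> \<Longrightarrow> norm x \<le> B"
    using dom bounded_closure[of \<Omega>] unfolding bounded_lipschitz_domain_def bounded_pos by blast
  \<comment> \<open>Radii up to \<open>2 * B\<close> suffice, since they will be distances between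
    two points of the closure.\<close>
  obtain \<eta> where \<eta>: "\<eta> > 0" and cork: "\<And>x r. x \<in> frontier \<Omega> \<Longrightarrow> 0 < r \<Longrightarrow> r \<le> 2 * B \<Longrightarrow>
      \<exists>c. ball c (\<eta> * r) \<subseteq> ball x r - \<Omega>"
    using bounded_lipschitz_domain_exterior_corkscrew[OF dom, of "2 * B"] B(1) by auto
  define C1 where "C1 = 2 * 2 powr p * 2 ^ CARD('n) / unit_ball_vol (real CARD('n))"
  define C2 where "C2 = 2 powr (real CARD('n) + p * t) / (unit_ball_vol (real CARD('n)) * \<eta> ^ CARD('n))"
  have C: "C1 > 0" "C2 > 0" using \<eta> by (simp_all add: C1_def C2_def)
  define M where "M = C1 powr (1 / p) + C2 powr (1 / p)"
  have M: "M > 0" "C1 powr (1 / p) \<le> M" "C2 powr (1 / p) \<le> M" using C by (auto simp: M_def intro: add_pos_pos)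
  have "norm (w x - w y) \<le> M * lam * norm (x - y) powr t"
    if w: "w \<in> borel_measurable lebesgue" and lam: "0 < lam" and zero: "\<And>x. x \<notin> \<Omega> \<Longrightarrow> w x = 0"
      and x: "x \<in> - \<Omega> \<union> {x. frac_density t p UNIV w x \<le> ennreal (lam powr p)}"
      and y: "y \<in> - \<Omega> \<union> {x. frac_density t p UNIV w x \<le> ennreal (lam powr p)}"
    for w :: "real^'n \<Rightarrow> real^'m" and lam x y
  proof -
    have int: "norm (w x - w y) \<le> M * lam * norm (x - y) powr t"
      if "frac_density t p UNIV w x \<le> ennreal (lam powr p)" "frac_density t p UNIV w y \<le> ennreal (lam powr p)" for x y
    proof -
      have "norm (w x - w y) powr p \<le> C1 * lam powr p * norm (x - y) powr (p * t)"
        unfolding C1_def using assms that by (intro norm_diff_powr_le_of_frac_density[OF w]) auto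
      then have "norm (w x - w y) \<le> C1 powr (1 / p) * lam * norm (x - y) powr t"
        using assms C lam by (intro le_of_powr_le) auto
      also have "\<dots> \<le> M * lam * norm (x - y) powr t"
        using M lam by (intro mult_right_mono) auto
      finally show ?thesis .
    qed
    have bd: "norm (w x) \<le> M * lam * norm (x - y) powr t"
      if x: "x \<in> \<Omega>" "frac_density t p UNIV w x \<le> ennreal (lam powr p)" and y: "y \<notin> \<Omega>" for x y
    proof -
      \<comment> \<open>The other endpoint may be far from \<Omega>, so it is replaced by a frontier
        point on the segment. This is no farther from \<open>x\<close> than \<open>y\<close> is and
        has exterior balls at the scale \<open>r\<close> of its distance to
        \<open>x\<close>.\<close>
      have "closed_segment x y \<inter> \<Omega> \<noteq> {}" "closed_segment x y - \<Omega> \<noteq> {}" using x y by auto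
      then obtain x0 where x0: "x0 \<in> closed_segment x y" "x0 \<in> frontier \<Omega>"
        using connected_Int_frontier[OF connected_segment] by blast
      define r where "r = norm (x0 - x)"
      have "x0 \<notin> \<Omega>" using x0 dom by (simp add: bounded_lipschitz_domain_def frontier_def interior_open)
      then have r: "r > 0" using x by (auto simp: r_def)
      have ry: "r \<le> norm (x - y)" using segment_bound(1)[OF x0(1)] by (simp add: r_def norm_minus_commute)
      have "x0 \<in> closure \<Omega>" "x \<in> closure \<Omega>" using x0 x closure_subset by (auto simp: frontier_def)
      then have "r \<le> 2 * B"
        unfolding r_def using B(2)[of x0] B(2)[of x] norm_triangle_ineq4[of x0 x] by linarith
      then obtain c where c: "ball c (\<eta> * r) \<subseteq> ball x0 r - \<Omega>" using cork x0 r by blast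
      \<comment> \<open>The radius doubles because \<open>x0\<close> itself is at distance
        \<open>r\<close> from \<open>x\<close>.\<close>
      have "ball x0 r \<subseteq> cball x (2 * r)"
      proof
        fix z assume "z \<in> ball x0 r"
        then show "z \<in> cball x (2 * r)"
          using dist_triangle[of x z x0] by (simp add: r_def dist_norm norm_minus_commute)
      qed
      then have "norm (w x) powr p \<le> C2 * lam powr p * r powr (p * t)"
        unfolding C2_def using c zero assms r \<eta> x
        by (intro norm_powr_le_of_frac_density_of_zero_ball[OF w, where c = c]) auto
      then have "norm (w x) \<le> C2 powr (1 / p) * lam * r powr t"
        using assms C lam r by (intro le_of_powr_le) auto
      also have "\<dots> \<le> M * lam * norm (x - y) powr t"
        using M lam r ry assms by (intro mult_mono powr_mono2) auto
      finally show ?thesis .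
    qed
    consider "x \<notin> \<Omega>" "y \<notin> \<Omega>" | "x \<in> \<Omega>" "y \<notin> \<Omega>" | "x \<notin> \<Omega>" "y \<in> \<Omega>" | "x \<in> \<Omega>" "y \<in> \<Omega>" by blast
    then show ?thesis
    proof cases
      case 1
      then show ?thesis using zero M lam by simp
    next
      case 2
      then show ?thesis using bd[of x y] x zero by simp
    next
      case 3
      then show ?thesis using bd[of y x] y zero by (simp add: norm_minus_commute)
    next
      case 4
      then show ?thesis using int[of x y] x y by simp
    qed
  qed
  with M(1) show ?thesis by blast
qed

section \<open>The tail of the density and the measure of the bad set\<close>

text \<open>Outside \<open>A\<close> the integrand is \<open>norm (w x) powr p\<close> times the
  bare kernel, since \<open>w y = 0\<close> there. This produces the Lp term of the final
  estimate.\<close>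

lemma frac_density_UNIV_le:
  fixes w :: "real^'n \<Rightarrow> real^'m"
  assumes w: "w \<in> borel_measurable lebesgue" and A: "A \<in> sets borel"
    and zero: "\<And>y. y \<notin> A \<Longrightarrow> w y = 0"
    and tail: "(\<integral>\<^sup>+y\<in>-A. ennreal (norm (x - y) powr - (real CARD('n) + p * t)) \<partial>lebesgue) \<le> ennreal C"
    and "0 \<le> C"
  shows "frac_density t p UNIV w x \<le> frac_density t p A w x + ennreal (C * norm (w x) powr p)"
proof -
  define a where "a = real CARD('n) + p * t"
  have [measurable]: "w \<in> borel_measurable lebesgue" "(\<lambda>z. z) \<in> borel_measurable lebesgue" "A \<in> sets lebesgue"
    using w A by (auto intro: measurable_completion)
  define F where "F y = ennreal (norm (w x - w y) powr p / norm (x - y) powr a)" for y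
  have [measurable]: "F \<in> borel_measurable lebesgue" unfolding F_def by measurable
  have "frac_density t p UNIV w x = (\<integral>\<^sup>+y. F y * indicator A y + F y * indicator (-A) y \<partial>lebesgue)"
    unfolding frac_density_def F_def a_def by (intro nn_integral_cong) (auto simp: indicator_def)
  also have "\<dots> = (\<integral>\<^sup>+y\<in>A. F y \<partial>lebesgue) + (\<integral>\<^sup>+y\<in>-A. F y \<partial>lebesgue)"
    by (rule nn_integral_add) measurable
  also have "(\<integral>\<^sup>+y\<in>A. F y \<partial>lebesgue) = frac_density t p A w x"
    by (simp add: frac_density_def F_def a_def)
  also have "(\<integral>\<^sup>+y\<in>-A. F y \<partial>lebesgue) =
      (\<integral>\<^sup>+y. ennreal (norm (w x) powr p) * (ennreal (norm (x - y) powr - a) * indicator (-A) y) \<partial>lebesgue)"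
    using zero by (intro nn_integral_cong)
      (auto simp: indicator_def F_def ennreal_mult'[symmetric] powr_minus_divide)
  also have "\<dots> = ennreal (norm (w x) powr p) * (\<integral>\<^sup>+y\<in>-A. ennreal (norm (x - y) powr - a) \<partial>lebesgue)"
    by (rule nn_integral_cmult) measurable
  also have "\<dots> \<le> ennreal (norm (w x) powr p) * ennreal C"
    using tail unfolding a_def by (rule mult_left_mono) simp
  also have "\<dots> = ennreal (norm (w x) powr p * C)"
    by (simp add: ennreal_mult')
  finally show ?thesis by (simp add: add_left_mono mult.commute)
qed

text \<open>In the far-field estimate the distance enters only through
  \<open>(2 * d) powr (- (p * t))\<close>; factoring it out leaves a constant independent of
  \<open>x\<close>, \<open>A\<close> and \<open>d\<close>.\<close>

lemma nn_integral_norm_powr_tail_scaling: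
  assumes "0 < t" "0 < p"
  shows "\<exists>C>0. \<forall>(x::real^'n) A d. 0 < d \<longrightarrow> (\<forall>y\<in>A. d \<le> norm (x - y)) \<longrightarrow>
    (\<integral>\<^sup>+y\<in>A. ennreal (norm (x - y) powr - (real CARD('n) + p * t)) \<partial>lebesgue) \<le> ennreal (C / d powr (p * t))"
proof -
  define a where "a = real CARD('n) + p * t"
  have a: "a > real DIM(real^'n)" "real DIM(real^'n) - a = - (p * t)" using assms by (auto simp: a_def)
  define C where "C = 2 powr \<bar>a\<bar> * unit_ball_vol (real DIM(real^'n)) * 2 powr (- (p * t)) / (1 - 2 powr (- (p * t)))"
  have "(2::real) powr (- (p * t)) < 2 powr 0" using assms by (intro powr_less_mono) auto
  then have "C > 0" by (simp add: C_def)
  moreover have "(\<integral>\<^sup>+y\<in>A. ennreal (norm (x - y) powr - (real CARD('n) + p * t)) \<partial>lebesgue) \<le> ennreal (C / d powr (p * t))"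
    if "0 < d" "\<forall>y\<in>A. d \<le> norm (x - y)" for x :: "real^'n" and A d
  proof -
    have "C / d powr (p * t) = 2 powr \<bar>a\<bar> * unit_ball_vol (real DIM(real^'n)) * (2 * d) powr (real DIM(real^'n) - a) /
      (1 - 2 powr (real DIM(real^'n) - a))"
      unfolding C_def a(2) using that by (simp add: powr_mult powr_minus_divide)
    then show ?thesis
      using nn_integral_norm_powr_far[OF a(1) that(1), of A x] that by (simp add: a_def)
  qed
  ultimately show ?thesis by blast
qed

text \<open>Markov's inequality for the majorant of the full density: its first summand integrates
  to at most the energy over \<open>A\<close>, its second to \<open>C\<close> times the Lp integral
  over \<open>U\<close>.\<close>

lemma emeasure_high_frac_density:
  fixes w :: "real^'n \<Rightarrow> real^'m"
  assumes w: "w \<in> borel_measurable lebesgue" and A: "A \<in> sets borel" "U \<in> sets borel" "U \<subseteq> A"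
    and fin: "gagliardo_energy t p A w < \<infinity>" and Lp: "set_integrable lebesgue U (\<lambda>x. norm (w x) powr p)"
    and "0 \<le> C" "0 < K"
  defines "B \<equiv> {x\<in>U. ennreal K < frac_density t p A w x + ennreal (C * norm (w x) powr p)}"
  shows "B \<in> sets lebesgue"
    and "emeasure lebesgue B \<le>
      ennreal ((enn2real (gagliardo_energy t p A w) + C * (LINT x:U|lebesgue. norm (w x) powr p)) / K)"
proof -
  have [measurable]: "w \<in> borel_measurable lebesgue" "U \<in> sets lebesgue" "frac_density t p A w \<in> borel_measurable lebesgue"
    using w A borel_measurable_frac_density by auto
  define G where "G x = frac_density t p A w x + ennreal (C * norm (w x) powr p)" for x
  have [measurable]: "G \<in> borel_measurable lebesgue" unfolding G_def by measurable
  have "{x \<in> space lebesgue. x \<in> U \<and> ennreal K < G x} \<in> sets lebesgue" by measurable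
  then show "B \<in> sets lebesgue" by (simp add: B_def G_def)
  have nn: "0 \<le> (LINT x:U|lebesgue. norm (w x) powr p)"
    unfolding set_lebesgue_integral_def by (intro integral_nonneg_AE) auto
  \<comment> \<open>Markov's inequality is used with threshold 1, so the level \<open>K\<close> is
    moved into the factor \<open>1 / K\<close>.\<close>
  have "B \<subseteq> {x\<in>U. 1 \<le> ennreal (1 / K) * G x}"
  proof -
    have "1 \<le> ennreal (1 / K) * G x" if "ennreal K < G x" for x
    proof -
      have "1 = ennreal (1 / K) * ennreal K" using assms by (simp add: ennreal_mult'[symmetric])
      also have "\<dots> \<le> ennreal (1 / K) * G x" using that by (intro mult_left_mono) auto
      finally show ?thesis .
    qed
    then show ?thesis by (auto simp: B_def G_def)
  qed
  then have "emeasure lebesgue B \<le> emeasure lebesgue {x\<in>U. 1 \<le> ennreal (1 / K) * G x}"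
  proof (rule emeasure_mono)
    have "{x \<in> space lebesgue. x \<in> U \<and> 1 \<le> ennreal (1 / K) * G x} \<in> sets lebesgue" by measurable
    then show "{x\<in>U. 1 \<le> ennreal (1 / K) * G x} \<in> sets lebesgue" by simp
  qed
  also have "\<dots> \<le> ennreal (1 / K) * (\<integral>\<^sup>+x\<in>U. G x \<partial>lebesgue)"
    by (rule nn_integral_Markov_inequality) measurable
  also have "(\<integral>\<^sup>+x\<in>U. G x \<partial>lebesgue) =
      (\<integral>\<^sup>+x. frac_density t p A w x * indicator U x + ennreal (C * norm (w x) powr p) * indicator U x \<partial>lebesgue)"
    by (simp add: G_def distrib_right)
  also have "\<dots> = (\<integral>\<^sup>+x\<in>U. frac_density t p A w x \<partial>lebesgue) + (\<integral>\<^sup>+x\<in>U. ennreal (C * norm (w x) powr p) \<partial>lebesgue)"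
    by (rule nn_integral_add) measurable
  also have "(\<integral>\<^sup>+x\<in>U. ennreal (C * norm (w x) powr p) \<partial>lebesgue) =
      (\<integral>\<^sup>+x. ennreal C * ennreal (indicator U x *\<^sub>R (norm (w x) powr p)) \<partial>lebesgue)"
    using assms by (intro nn_integral_cong) (auto simp: indicator_def ennreal_mult'[symmetric])
  also have "\<dots> = ennreal C * (\<integral>\<^sup>+x. ennreal (indicator U x *\<^sub>R (norm (w x) powr p)) \<partial>lebesgue)"
    by (rule nn_integral_cmult) measurable
  also have "(\<integral>\<^sup>+x. ennreal (indicator U x *\<^sub>R (norm (w x) powr p)) \<partial>lebesgue) =
      ennreal (LINT x:U|lebesgue. norm (w x) powr p)"
    using Lp unfolding set_lebesgue_integral_def set_integrable_def
    by (intro nn_integral_eq_integral) auto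
  also have "(\<integral>\<^sup>+x\<in>U. frac_density t p A w x \<partial>lebesgue) \<le> gagliardo_energy t p A w"
    unfolding gagliardo_energy_eq_frac_density using A(3)
    by (intro nn_integral_mono) (auto simp: indicator_def)
  \<comment> \<open>Finiteness is essential here, as \<open>enn2real\<close> sends infinity to
    0.\<close>
  also have "gagliardo_energy t p A w = ennreal (enn2real (gagliardo_energy t p A w))"
    using fin by (simp add: ennreal_enn2real)
  finally show "emeasure lebesgue B \<le>
      ennreal ((enn2real (gagliardo_energy t p A w) + C * (LINT x:U|lebesgue. norm (w x) powr p)) / K)"
    using assms(7,8) nn
    by (simp add: ennreal_mult'[symmetric] ennreal_plus[symmetric] mult_left_mono add_right_mono del: ennreal_plus)
qed

section \<open>Hoelder truncation of functions in \<open>X0_space\<close>\<close>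

text \<open>Local integrability gives measurability on the compact closure of \<Omega>, and the
  representative vanishes everywhere else.\<close>

lemma X0_space_borel_measurable:
  fixes w :: "real^'n \<Rightarrow> real^'m"
  assumes "w \<in> X0_space s t p \<Omega> \<Omega>'" "bounded \<Omega>" "\<And>x. x \<notin> \<Omega> \<Longrightarrow> w x = 0"
  shows "w \<in> borel_measurable lebesgue"
proof -
  have "w absolutely_integrable_on closure \<Omega>"
    using assms(1,2) by (simp add: X0_space_def L1_tail_def compact_closure)
  then have "(\<lambda>x. indicator (closure \<Omega>) x *\<^sub>R w x) \<in> borel_measurable lebesgue"
    unfolding set_integrable_def by (rule borel_measurable_integrable)
  moreover have "(\<lambda>x. indicator (closure \<Omega>) x *\<^sub>R w x) = w"
    using assms(3) closure_subset[of \<Omega>] by (fastforce simp: indicator_def)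
  ultimately show ?thesis by simp
qed

theorem proposition6p2:
  fixes \<Omega> :: "(real^'n) set" and t p :: real
  assumes "CARD('n) \<ge> 2"
    and "p \<ge> 1"
    and "0 < t" and "t < 1"
    and "bounded_lipschitz_domain \<Omega>"
  shows "\<exists>c>0. \<forall>s \<Omega>'. \<forall>w :: real^'n \<Rightarrow> real^'m.
    0 < s \<longrightarrow> s < 1 \<longrightarrow>
    open \<Omega>' \<longrightarrow> bounded \<Omega>' \<longrightarrow> closure \<Omega> \<subseteq> \<Omega>' \<longrightarrow>
    w \<in> X0_space s t p \<Omega> \<Omega>' \<longrightarrow> (\<forall>x. x \<notin> \<Omega> \<longrightarrow> w x = 0) \<longrightarrow>
    (\<forall>lam>0. \<exists>wl \<in> holder_space t UNIV.
       {x. wl x \<noteq> w x} \<subseteq> \<Omega> \<and>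
       holder_seminorm t UNIV wl \<le> ennreal (c * lam) \<and>
       emeasure lebesgue {x. wl x \<noteq> w x} \<le>
         ennreal (c / lam powr p *
           (gagliardo_seminorm t p \<Omega>' w powr p +
            Lp_norm p \<Omega> w powr p / setdist \<Omega> (- \<Omega>') powr (p * t))) \<and>
       (\<forall>t'. 0 < t' \<longrightarrow> t' < t \<longrightarrow> wl \<in> X0_space s t' p \<Omega> \<Omega>'))"
proof -
  have \<Omega>: "open \<Omega>" "bounded \<Omega>" using assms(5) by (auto simp: bounded_lipschitz_domain_def)
  obtain M where M: "M > 0" and hol: "\<And>(w :: real^'n \<Rightarrow> real^'m) lam x y. w \<in> borel_measurable lebesgue \<Longrightarrow> 0 < lam \<Longrightarrow>
      (\<And>x. x \<notin> \<Omega> \<Longrightarrow> w x = 0) \<Longrightarrow>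
      x \<in> - \<Omega> \<union> {x. frac_density t p UNIV w x \<le> ennreal (lam powr p)} \<Longrightarrow>
      y \<in> - \<Omega> \<union> {x. frac_density t p UNIV w x \<le> ennreal (lam powr p)} \<Longrightarrow>
      norm (w x - w y) \<le> M * lam * norm (x - y) powr t"
    using holder_on_low_frac_density[OF assms(5), of t p, where 'm = 'm] assms(2,3) by force
  obtain C where C: "C > 0" and tail: "\<And>(x::real^'n) A d. 0 < d \<Longrightarrow> (\<And>y. y \<in> A \<Longrightarrow> d \<le> norm (x - y)) \<Longrightarrow>
    (\<integral>\<^sup>+y\<in>A. ennreal (norm (x - y) powr - (real CARD('n) + p * t)) \<partial>lebesgue) \<le> ennreal (C / d powr (p * t))"
    using nn_integral_norm_powr_tail_scaling[of t p, where 'n = 'n] assms by force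
  \<comment> \<open>The three summands dominate the constants of the Hoelder extension, of the tail
    term and of the energy term.\<close>
  define c where "c = real CARD('m) * M + C + 1"
  have c: "c > 0" "real CARD('m) * M \<le> c" "C \<le> c" "1 \<le> c" using M C by (auto simp: c_def add_pos_pos)
  have "\<exists>wl \<in> holder_space t UNIV.
       {x. wl x \<noteq> w x} \<subseteq> \<Omega> \<and>
       holder_seminorm t UNIV wl \<le> ennreal (c * lam) \<and>
       emeasure lebesgue {x. wl x \<noteq> w x} \<le>
         ennreal (c / lam powr p *
           (gagliardo_seminorm t p \<Omega>' w powr p +
            Lp_norm p \<Omega> w powr p / setdist \<Omega> (- \<Omega>') powr (p * t))) \<and>
       (\<forall>t'. 0 < t' \<longrightarrow> t' < t \<longrightarrow> wl \<in> X0_space s t' p \<Omega> \<Omega>')"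
    if \<Omega>': "open \<Omega>'" "bounded \<Omega>'" "closure \<Omega> \<subseteq> \<Omega>'"
      and w: "w \<in> X0_space s t p \<Omega> \<Omega>'" and zero: "\<And>x. x \<notin> \<Omega> \<Longrightarrow> w x = 0" and lam: "lam > 0"
    for s \<Omega>' lam and w :: "real^'n \<Rightarrow> real^'m"
  proof -
    have meas: "w \<in> borel_measurable lebesgue" by (rule X0_space_borel_measurable[OF w \<Omega>(2) zero])
    have sub: "\<Omega> \<subseteq> \<Omega>'" using \<Omega>'(3) closure_subset by blast
    define E where "E = - \<Omega> \<union> {x. frac_density t p UNIV w x \<le> ennreal (lam powr p)}"
    \<comment> \<open>McShane's infimum needs a nonempty set; a bounded \<Omega> has points in its
      complement.\<close>
    have "\<Omega> \<noteq> UNIV" using \<Omega>(2) not_bounded_UNIV by blast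
    then have "E \<noteq> {}" unfolding E_def by blast
    obtain v where v: "\<And>x. x \<in> E \<Longrightarrow> v x = w x"
      "\<And>x y. norm (v x - v y) \<le> real CARD('m) * (M * lam) * norm (x - y) powr t"
    proof (rule holder_extension_vec[OF \<open>E \<noteq> {}\<close>, of t "M * lam" w])
      show "norm (w x - w y) \<le> M * lam * norm (x - y) powr t" if "x \<in> E" "y \<in> E" for x y
        using hol[OF meas lam zero] that by (simp add: E_def)
    qed (use assms M lam in auto)
    have "real CARD('m) * (M * lam) = (real CARD('m) * M) * lam" by simp
    also have "\<dots> \<le> c * lam" using c lam by (intro mult_right_mono) auto
    finally have "real CARD('m) * (M * lam) \<le> c * lam" .
    then have vh: "norm (v x - v y) \<le> c * lam * norm (x - y) powr t" for x y
      using v(2)[of x y] by (meson mult_right_mono order_trans powr_ge_zero)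
    have clam: "0 \<le> c * lam" using c lam by simp
    have neq: "{x. v x \<noteq> w x} \<subseteq> - E" using v(1) by auto
    have v0: "v x = 0" if "x \<notin> \<Omega>" for x using v(1)[of x] zero that by (simp add: E_def)
    have semi: "holder_seminorm t UNIV v \<le> ennreal (c * lam)"
      by (rule holder_seminorm_le[OF vh])
    then have "holder_seminorm t UNIV v < \<infinity>" by (rule order_le_less_trans) simp
    then have "v \<in> holder_space t UNIV"
      using holder_bounded_support_imp_bounded[OF assms(3) vh \<Omega>(2) v0] by (simp add: holder_space_def)
    moreover have "v \<in> X0_space s t' p \<Omega> \<Omega>'" if "t' < t" for t'
      using holder_bounded_support_imp_X0[OF assms(3) that assms(2) clam vh \<Omega>(2) v0 \<Omega>'(1,2)] .
    moreover have "{x. v x \<noteq> w x} \<subseteq> \<Omega>" using neq by (auto simp: E_def)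
    moreover have "emeasure lebesgue {x. v x \<noteq> w x} \<le>
         ennreal (c / lam powr p *
           (gagliardo_seminorm t p \<Omega>' w powr p +
            Lp_norm p \<Omega> w powr p / setdist \<Omega> (- \<Omega>') powr (p * t)))"
    \<comment> \<open>For empty \<Omega> the value of \<open>setdist\<close> is 0 by convention, so
      positivity of the distance is only available in the other case.\<close>
    proof (cases "\<Omega> = {}")
      case True
      then have "{x. v x \<noteq> w x} = {}" using neq by (auto simp: E_def)
      then show ?thesis by simp
    next
      case False
      define d where "d = setdist \<Omega> (- \<Omega>')"
      have "\<Omega>' \<noteq> UNIV" using \<Omega>'(2) not_bounded_UNIV by blast
      then have "- \<Omega>' \<noteq> {}" by blast
      \<comment> \<open>Passing to the closure does not change the distance, and a compact set is at
        positive distance from a disjoint closed one.\<close>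
      then have "setdist (closure \<Omega>) (- \<Omega>') > 0"
        using False \<Omega>' \<Omega>(2) by (subst setdist_gt_0_compact_closed) (auto simp: compact_closure)
      then have d: "d > 0" by (simp add: d_def)
      have fd: "frac_density t p UNIV w x \<le> frac_density t p \<Omega>' w x + ennreal (C / d powr (p * t) * norm (w x) powr p)"
        if "x \<in> \<Omega>" for x
      proof (rule frac_density_UNIV_le[OF meas])
        show "\<Omega>' \<in> sets borel" using \<Omega>'(1) by simp
        show "w y = 0" if "y \<notin> \<Omega>'" for y using zero sub that by blast
        show "(\<integral>\<^sup>+y\<in>- \<Omega>'. ennreal (norm (x - y) powr - (real CARD('n) + p * t)) \<partial>lebesgue) \<le> ennreal (C / d powr (p * t))"
          using that by (intro tail d) (auto simp: d_def setdist_le_dist dist_norm[symmetric])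
        show "0 \<le> C / d powr (p * t)" using C by simp
      qed
      define B where "B = {x\<in>\<Omega>. ennreal (lam powr p) <
        frac_density t p \<Omega>' w x + ennreal (C / d powr (p * t) * norm (w x) powr p)}"
      \<comment> \<open>A point outside \<open>E\<close> lies in \<Omega> and has full density above
        the level, so by \<open>fd\<close> the majorant exceeds the level too.\<close>
      have "- E \<subseteq> B" using fd by (auto simp: E_def B_def not_le intro: order_less_le_trans)
      have fin: "gagliardo_energy t p \<Omega>' w < \<infinity>" and "set_integrable lebesgue \<Omega>' (\<lambda>x. norm (w x) powr p)"
        using w by (auto simp: X0_space_def frac_sobolev_def Lp_space_def)
      then have Lp: "set_integrable lebesgue \<Omega> (\<lambda>x. norm (w x) powr p)"
        using sub \<Omega>(1) by (intro set_integrable_subset[of lebesgue \<Omega>' _ \<Omega>]) auto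
      define I where "I = (LINT x:\<Omega>|lebesgue. norm (w x) powr p)"
      have I: "I \<ge> 0" unfolding I_def set_lebesgue_integral_def by (intro integral_nonneg_AE) auto
      define e where "e = enn2real (gagliardo_energy t p \<Omega>' w)"
      have e: "e \<ge> 0" by (simp add: e_def)
      have sets: "\<Omega>' \<in> sets borel" "\<Omega> \<in> sets borel" using \<Omega> \<Omega>' by auto
      have Cd: "0 \<le> C / d powr (p * t)" "0 < lam powr p" using C lam by auto
      note B = emeasure_high_frac_density[OF meas sets sub fin Lp Cd, folded B_def I_def e_def]
      have "emeasure lebesgue {x. v x \<noteq> w x} \<le> emeasure lebesgue B"
        using neq \<open>- E \<subseteq> B\<close> B(1) by (intro emeasure_mono) auto
      also have "\<dots> \<le> ennreal ((e + C / d powr (p * t) * I) / lam powr p)" by (rule B(2))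
      also have "\<dots> \<le> ennreal (c / lam powr p * (e + I / d powr (p * t)))"
      proof (rule ennreal_leI)
        have "e + C / d powr (p * t) * I \<le> c * e + c * (I / d powr (p * t))"
        proof (rule add_mono)
          show "e \<le> c * e" using c e mult_right_mono[of 1 c e] by simp
          have "C * (I / d powr (p * t)) \<le> c * (I / d powr (p * t))"
            using c I by (intro mult_right_mono) auto
          then show "C / d powr (p * t) * I \<le> c * (I / d powr (p * t))" by simp
        qed
        then have "(e + C / d powr (p * t) * I) / lam powr p \<le> (c * e + c * (I / d powr (p * t))) / lam powr p"
          by (rule divide_right_mono) simp
        also have "\<dots> = c / lam powr p * (e + I / d powr (p * t))"
          by (simp add: distrib_left add_divide_distrib mult.commute)
        finally show "(e + C / d powr (p * t) * I) / lam powr p \<le> c / lam powr p * (e + I / d powr (p * t))" .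
      qed
      \<comment> \<open>The outer power \<open>p\<close> undoes the root \<open>1 / p\<close> in the
        seminorm, and likewise in the Lp norm.\<close>
      also have "e = gagliardo_seminorm t p \<Omega>' w powr p"
        using assms(2) e by (simp add: gagliardo_seminorm_def powr_powr e_def)
      also have "I = Lp_norm p \<Omega> w powr p"
        using assms(2) I by (simp add: Lp_norm_def powr_powr I_def)
      finally show ?thesis by (simp add: d_def)
    qed
    ultimately show ?thesis using semi by blast
  qed
  then show ?thesis using c(1) by blast
qed

end
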